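(* Let $(f_{\mathbf{a}})_{\mathbf{a}\in\mathscr{C}}$ be a finitely supported family of rational functions in $\mathbf{C}(T)$ indexed by the set $\mathscr{C}$ of all compositions (so that the numbers $f_{\mathbf{a}}(n)$ are defined for all $n$ large enough). Assume that the numbers $F(n)=\sum_{\mathbf{a}\in\mathscr{C}}f_{\mathbf{a}}(n)\,\sigma(\mathbf{a})_n$ vanish for all $n$ large enough. Then $f_{\mathbf{a}}=0$ for all $\mathbf{a}\in\mathscr{C}$.
   Context: A composition is a finite sequence $\mathbf{a}=(a_1,\ldots,a_r)$ of positive integers, $r\geqslant0$ (the empty sequence $\varnothing$ included); $\mathscr{C}$ is the set of all compositions. For a composition $\mathbf{a}$ of depth $r\geqslant1$ and an integer $n\geqslant 0$, $\sigma(\mathbf{a})_n=\sum_{n_1>\cdots>n_r>n}\binom{2n_1}{n_1}^{-1}n_1^{-a_1}\cdots n_r^{-a_r}$, and $\sigma(\varnothing)_n=\binom{2n}{n}^{-1}$. *)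

theory Defs
  imports
    "HOL-Analysis.Analysis"
    "HOL-Computational_Algebra.Computational_Algebra"
    "HOL-Computational_Algebra.Field_as_Ring"
begin

definition compositions :: "nat list set" where
  "compositions = {a. \<forall>k\<in>set a. k > 0}"

text \<open>
  Value of a rational function in lowest terms. At a pole the value is the junk value \<open>0\<close>;
  each rational function has only finitely many poles.
\<close>

definition eval_fract :: "complex poly fract \<Rightarrow> complex \<Rightarrow> complex" where
  "eval_fract f z = poly (fst (quot_of_fract f)) z / poly (snd (quot_of_fract f)) z"

lemma eval_fract_Fract:
  assumes "poly q z \<noteq> 0"
  shows "eval_fract (Fraction_Field.Fract p q) z = poly p z / poly q z"
proof -
  have "q \<noteq> 0" using assms by auto
  have quot: "quot_of_fract (Fraction_Field.Fract p q) = normalize_quot (p, q)"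
    using quot_of_fract_quot_to_fract[of "(p, q)"] by (simp add: quot_to_fract_def)
  from \<open>q \<noteq> 0\<close> obtain d where
    d: "p = fst (normalize_quot (p, q)) * d" "q = snd (normalize_quot (p, q)) * d"
    using normalize_quotE[of q p] by metis
  have p: "poly p z = poly (fst (normalize_quot (p, q))) z * poly d z"
    by (subst d(1)) simp
  have q: "poly q z = poly (snd (normalize_quot (p, q))) z * poly d z"
    by (subst d(2)) simp
  from assms q have "poly d z \<noteq> 0" by auto
  then show ?thesis by (simp add: eval_fract_def quot p q)
qed

text \<open>
  The index set consists of the tuples \<open>n\<^sub>1 > \<dots> > n\<^sub>r > n\<close>, written as lists, so that
  \<open>hd ns\<close> is \<open>n\<^sub>1\<close>. The terms are nonnegative and the family is summable.
\<close>

definition comp_tail :: "nat list \<Rightarrow> nat \<Rightarrow> real" where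
  "comp_tail a n =
     (if a = [] then inverse (real ((2 * n) choose n))
      else (\<Sum>\<^sub>\<infinity>ns \<in> {ns. length ns = length a \<and> sorted_wrt (>) ns \<and> (\<forall>m\<in>set ns. m > n)}.
              inverse (real ((2 * hd ns) choose (hd ns))) *
              (\<Prod>i<length a. inverse (real (ns ! i) ^ (a ! i)))))"

end

theory Submission
  imports Defs
begin

text \<open>
  The tails satisfy \<open>\<sigma>(a)\<^bsub>n-1\<^esub> = \<sigma>(a)\<^bsub>n\<^esub> + n\<^sup>-\<^sup>k \<sigma>(b)\<^bsub>n\<^esub>\<close> when \<open>a\<close> is \<open>b\<close> followed by \<open>k\<close>, and
  \<open>\<sigma>(\<emptyset>)\<^bsub>n-1\<^esub> = (4n-2)/n \<cdot> \<sigma>(\<emptyset>)\<^bsub>n\<^esub>\<close>. Take a relation \<open>F(n) = 0\<close> supported on a prefix-closed finite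
  set and divide by the coefficient of an element \<open>a\<close> of maximal depth. Then \<open>F(n-1) - F(n) = 0\<close> is a
  relation not involving \<open>a\<close>, so by induction its coefficients vanish. Hence the coefficients of
  maximal depth are constant, and the coefficient \<open>g\<close> of the composition \<open>b\<close> obtained from \<open>a\<close> by
  dropping its last entry satisfies \<open>u(T) g(T-1) - g(T) + \<Sum>\<^sub>k c\<^sub>k T\<^sup>-\<^sup>k = 0\<close> with \<open>u = 1\<close> or
  \<open>u = (4T-2)/T\<close> and some constant \<open>c\<^sub>k \<noteq> 0\<close>. Looking at the leftmost and rightmost poles of \<open>g\<close> shows
  that \<open>g\<close> is a polynomial, and then degrees give a contradiction.
\<close>

section \<open>Germs of rational functions at infinity\<close>

text \<open>Coefficients are sequences up to eventual equality, not elements of the fraction field: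
  poles, junk values and the truncated \<open>n - 1\<close> then disappear, and quotients and shifts
  are taken pointwise.\<close>

definition rat_germ :: "(nat \<Rightarrow> complex) \<Rightarrow> bool" where
  "rat_germ g \<longleftrightarrow> (\<exists>p q. q \<noteq> 0 \<and>
     (\<forall>\<^sub>F n in sequentially. g n = poly p (of_nat n) / poly q (of_nat n)))"

lemma eventually_poly_nonzero:
  fixes q :: "complex poly"
  assumes "q \<noteq> 0"
  shows "\<forall>\<^sub>F n in sequentially. poly q (of_nat n) \<noteq> 0"
proof -
  have "finite (of_nat -` {z. poly q z = 0} :: nat set)"
    using poly_roots_finite[OF assms] by (rule finite_vimageI) (simp add: inj_on_def)
  then show ?thesis
    by (simp add: cofinite_eq_sequentially [symmetric] eventually_cofinite vimage_def)
qed

lemma poly_eq_if_eventually_eq: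
  fixes p q :: "complex poly"
  assumes "\<forall>\<^sub>F n in sequentially. poly p (of_nat n) = poly q (of_nat n)"
  shows "p = q"
proof (rule ccontr)
  assume "p \<noteq> q"
  then have "\<forall>\<^sub>F n in sequentially. poly (p - q) (of_nat n) \<noteq> 0"
    by (intro eventually_poly_nonzero) simp
  with assms have "\<forall>\<^sub>F n in sequentially. False"
    by eventually_elim simp
  then show False by simp
qed

lemma rat_germI:
  assumes "q \<noteq> 0" "\<forall>\<^sub>F n in sequentially. g n = poly p (of_nat n) / poly q (of_nat n)"
  shows "rat_germ g"
  using assms unfolding rat_germ_def by blast

lemma rat_germ_const: "rat_germ (\<lambda>n. c)"
  by (rule rat_germI[of 1 _ "[:c:]"]) auto

lemma rat_germ_of_nat: "rat_germ of_nat"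
  by (rule rat_germI[of 1 _ "[:0, 1:]"]) auto

lemma rat_germ_add:
  assumes "rat_germ f" "rat_germ g"
  shows "rat_germ (\<lambda>n. f n + g n)"
proof -
  obtain p q where q: "q \<noteq> 0"
    and f: "\<forall>\<^sub>F n in sequentially. f n = poly p (of_nat n) / poly q (of_nat n)"
    using assms(1) unfolding rat_germ_def by blast
  obtain r s where s: "s \<noteq> 0"
    and g: "\<forall>\<^sub>F n in sequentially. g n = poly r (of_nat n) / poly s (of_nat n)"
    using assms(2) unfolding rat_germ_def by blast
  have "\<forall>\<^sub>F n in sequentially.
          f n + g n = poly (p * s + r * q) (of_nat n) / poly (q * s) (of_nat n)"
    using f g eventually_poly_nonzero[OF q] eventually_poly_nonzero[OF s]
    by eventually_elim (simp add: field_simps)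
  moreover have "q * s \<noteq> 0" using q s by simp
  ultimately show ?thesis by (intro rat_germI)
qed

lemma rat_germ_mult:
  assumes "rat_germ f" "rat_germ g"
  shows "rat_germ (\<lambda>n. f n * g n)"
proof -
  obtain p q where q: "q \<noteq> 0"
    and f: "\<forall>\<^sub>F n in sequentially. f n = poly p (of_nat n) / poly q (of_nat n)"
    using assms(1) unfolding rat_germ_def by blast
  obtain r s where s: "s \<noteq> 0"
    and g: "\<forall>\<^sub>F n in sequentially. g n = poly r (of_nat n) / poly s (of_nat n)"
    using assms(2) unfolding rat_germ_def by blast
  have "\<forall>\<^sub>F n in sequentially. f n * g n = poly (p * r) (of_nat n) / poly (q * s) (of_nat n)"
    using f g by eventually_elim simp
  moreover have "q * s \<noteq> 0" using q s by simp
  ultimately show ?thesis by (intro rat_germI)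
qed

lemma rat_germ_inverse:
  assumes "rat_germ f"
  shows "rat_germ (\<lambda>n. inverse (f n))"
proof -
  obtain p q where q: "q \<noteq> 0"
    and f: "\<forall>\<^sub>F n in sequentially. f n = poly p (of_nat n) / poly q (of_nat n)"
    using assms unfolding rat_germ_def by blast
  show ?thesis
  proof (cases "p = 0")
    case True
    \<comment> \<open>With the convention \<open>inverse 0 = 0\<close>, the inverse of the zero germ
      is the zero germ.\<close>
    have "\<forall>\<^sub>F n in sequentially. inverse (f n) = poly 0 (of_nat n) / poly 1 (of_nat n)"
      using f by eventually_elim (simp add: True)
    then show ?thesis by (rule rat_germI[rotated]) simp
  next
    case False
    have "\<forall>\<^sub>F n in sequentially. inverse (f n) = poly q (of_nat n) / poly p (of_nat n)"
      using f by eventually_elim simp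
    with False show ?thesis by (rule rat_germI)
  qed
qed

lemma rat_germ_diff: "rat_germ f \<Longrightarrow> rat_germ g \<Longrightarrow> rat_germ (\<lambda>n. f n - g n)"
  using rat_germ_add[of f "\<lambda>n. -1 * g n"] rat_germ_mult[OF rat_germ_const[of "-1"], of g] by simp

lemma rat_germ_divide: "rat_germ f \<Longrightarrow> rat_germ g \<Longrightarrow> rat_germ (\<lambda>n. f n / g n)"
  by (simp add: divide_inverse rat_germ_mult rat_germ_inverse)

lemma rat_germ_power: "rat_germ f \<Longrightarrow> rat_germ (\<lambda>n. f n ^ k)"
  by (induction k) (auto intro: rat_germ_const rat_germ_mult)

lemma rat_germ_sum: "(\<And>i. i \<in> I \<Longrightarrow> rat_germ (f i)) \<Longrightarrow> rat_germ (\<lambda>n. \<Sum>i\<in>I. f i n)"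
  by (induction I rule: infinite_finite_induct) (auto intro: rat_germ_const rat_germ_add)

lemma eventually_sequentially_pred:
  assumes "eventually P sequentially"
  shows "\<forall>\<^sub>F n in sequentially. P (n - 1 :: nat)"
proof -
  from assms obtain N where "\<And>n. n \<ge> N \<Longrightarrow> P n" by (auto simp: eventually_sequentially)
  then show ?thesis by (intro eventually_sequentiallyI[of "Suc N"]) simp
qed

lemma rat_germ_pred:
  assumes "rat_germ f"
  shows "rat_germ (\<lambda>n. f (n - 1))"
proof -
  obtain p q where q: "q \<noteq> 0"
    and f: "\<forall>\<^sub>F n in sequentially. f n = poly p (of_nat n) / poly q (of_nat n)"
    using assms unfolding rat_germ_def by blast
  \<comment> \<open>Composition with \<open>[:-1, 1:]\<close> substitutes \<open>T - 1\<close> for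
    \<open>T\<close>.\<close>
  have "\<forall>\<^sub>F n in sequentially. f (n - 1) =
          poly (p \<circ>\<^sub>p [:-1, 1:]) (of_nat n) / poly (q \<circ>\<^sub>p [:-1, 1:]) (of_nat n)"
    using eventually_sequentially_pred[OF f] eventually_gt_at_top[of 0]
    by eventually_elim (simp add: poly_pcompose of_nat_diff)
  moreover have "q \<circ>\<^sub>p [:-1, 1:] \<noteq> 0"
    using q pcompose_eq_0[of q "[:-1, 1:]"] by auto
  ultimately show ?thesis by (intro rat_germI)
qed

text \<open>A nonzero numerator has finitely many roots. This dichotomy allows division by any
  coefficient that is not eventually zero.\<close>

lemma rat_germ_zero_or_nonzero:
  assumes "rat_germ f"
  shows "(\<forall>\<^sub>F n in sequentially. f n = 0) \<or> (\<forall>\<^sub>F n in sequentially. f n \<noteq> 0)"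
proof -
  obtain p q where q: "q \<noteq> 0"
    and f: "\<forall>\<^sub>F n in sequentially. f n = poly p (of_nat n) / poly q (of_nat n)"
    using assms unfolding rat_germ_def by blast
  show ?thesis
  proof (cases "p = 0")
    case True
    then have "\<forall>\<^sub>F n in sequentially. f n = 0" using f by simp
    then show ?thesis ..
  next
    case False
    have "\<forall>\<^sub>F n in sequentially. f n \<noteq> 0"
      using f eventually_poly_nonzero[OF q] eventually_poly_nonzero[OF False]
      by eventually_elim simp
    then show ?thesis ..
  qed
qed

text \<open>In lowest terms the roots of \<open>q\<close> are genuine poles, as the pole argument
  below requires.\<close>

lemma rat_germ_coprime:
  assumes "rat_germ g"
  obtains p q where "q \<noteq> 0" "coprime p q"
    "\<forall>\<^sub>F n in sequentially. g n = poly p (of_nat n) / poly q (of_nat n)"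
proof -
  obtain p q where q: "q \<noteq> 0"
    and g: "\<forall>\<^sub>F n in sequentially. g n = poly p (of_nat n) / poly q (of_nat n)"
    using assms unfolding rat_germ_def by blast
  define d where "d = gcd p q"
  have d: "d \<noteq> 0" "p = (p div d) * d" "q = (q div d) * d" using q by (auto simp: d_def)
  have "\<forall>\<^sub>F n in sequentially. g n = poly (p div d) (of_nat n) / poly (q div d) (of_nat n)"
    using g eventually_poly_nonzero[OF d(1)]
  proof eventually_elim
    case (elim n)
    then show ?case
      by (metis d(2) d(3) mult_divide_mult_cancel_right poly_mult)
  qed
  moreover have "coprime (p div d) (q div d)"
    using q unfolding d_def by (intro div_gcd_coprime) auto
  moreover have "q div d \<noteq> 0" using d q by (metis mult_zero_left)
  ultimately show ?thesis using that by blast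
qed

section \<open>A difference equation\<close>

text \<open>
  Multiplying by \<open>T\<^sup>K\<close> can only kill a pole of \<open>g(T)\<close> at \<open>0\<close>, so the leftmost pole of \<open>g\<close> is \<open>0\<close>;
  multiplying by \<open>w\<close> can only kill poles of \<open>g(T - 1)\<close> with real part less than \<open>1\<close>, so the
  rightmost pole of \<open>g\<close> has negative real part.
\<close>

lemma no_poles_of_difference_equation:
  fixes p q w P :: "complex poly"
  assumes q: "q \<noteq> 0" and cop: "coprime p q"
    and w: "\<And>z. poly w z = 0 \<Longrightarrow> Re z < 1"
    and eq: "w * (p \<circ>\<^sub>p [:-1, 1:]) * q - [:0, 1:] ^ K * p * (q \<circ>\<^sub>p [:-1, 1:])
               + P * q * (q \<circ>\<^sub>p [:-1, 1:]) = 0"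
  shows "degree q = 0"
proof (rule ccontr)
  assume "degree q \<noteq> 0"
  \<comment> \<open>The hypothesis \<open>eq\<close> is
    \<open>w(T) g(T-1) - T^K g(T) + P(T) = 0\<close> for \<open>g = p/q\<close>, cleared of
    denominators; \<open>R\<close> is the set of poles of \<open>g\<close>.\<close>
  define R where "R = {z. poly q z = 0}"
  have fin: "finite R" unfolding R_def using q by (rule poly_roots_finite)
  have ne: "R \<noteq> {}"
    using fundamental_theorem_of_algebra[of q] \<open>degree q \<noteq> 0\<close>
    by (auto simp: R_def constant_degree)
  have p_nz: "poly p z \<noteq> 0" if "poly q z = 0" for z
    using that cop by (metis coprime_poly_0)
  have eqz: "poly w z * poly p (z - 1) * poly q z - z ^ K * poly p z * poly q (z - 1)
               + poly P z * poly q z * poly q (z - 1) = 0" for z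
    using arg_cong[OF eq, of "\<lambda>r. poly r z"] by (simp add: poly_pcompose algebra_simps)
  obtain b where b: "b \<in> R" "\<And>z. z \<in> R \<Longrightarrow> Re b \<le> Re z"
    using ex_is_arg_min_if_finite[OF fin ne, of Re] by (auto simp: is_arg_min_def not_less)
  obtain c where c: "c \<in> R" "\<And>z. z \<in> R \<Longrightarrow> Re z \<le> Re c"
    using ex_is_arg_min_if_finite[OF fin ne, of "\<lambda>z. - Re z"]
    by (auto simp: is_arg_min_def not_less)
  \<comment> \<open>At \<open>b\<close> the factor \<open>q(b) = 0\<close> leaves only
    \<open>b^K p(b) q(b-1) = 0\<close>.\<close>
  have "b - 1 \<notin> R" using b(2)[of "b - 1"] by auto
  then have "b = 0"
    using eqz[of b] b(1) p_nz[of b] by (auto simp: R_def)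
  \<comment> \<open>At \<open>c + 1\<close> the factor \<open>q(c) = 0\<close> leaves only
    \<open>w(c+1) p(c) q(c+1) = 0\<close>.\<close>
  have "c + 1 \<notin> R" using c(2)[of "c + 1"] by auto
  then have "poly w (c + 1) = 0"
    using eqz[of "c + 1"] c(1) p_nz[of c] by (auto simp: R_def)
  then have "Re c < 0" using w[of "c + 1"] by simp
  with b(2)[OF c(1)] \<open>b = 0\<close> show False by simp
qed

text \<open>Here \<open>P = T^(K-1) B\<close> with \<open>B = T r(T) - v(T) r(T-1)\<close>, so if
  \<open>P\<close> is nonzero the degree bound makes \<open>B\<close> a nonzero constant. But for
  \<open>v = T\<close> it is a multiple of \<open>T\<close>, and for \<open>v = 4T - 2\<close> its
  coefficient in degree \<open>deg r + 1\<close> is \<open>1 - 4 = -3\<close> times the leading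
  coefficient of \<open>r\<close>.\<close>

lemma difference_equation_polynomial:
  fixes r P v :: "complex poly"
  assumes v: "v = [:0, 1:] \<or> v = [:-2, 4:]"
    and K: "K > 0" "degree P < K"
    and eq: "v * [:0, 1:] ^ (K - 1) * (r \<circ>\<^sub>p [:-1, 1:]) - [:0, 1:] ^ K * r + P = 0"
  shows "P = 0"
proof (rule ccontr)
  assume "P \<noteq> 0"
  define B where "B = [:0, 1:] * r - v * (r \<circ>\<^sub>p [:-1, 1:])"
  have "[:0, 1:] ^ K = ([:0, 1:] * [:0, 1:] ^ (K - 1) :: complex poly)"
    using K(1) by (metis power_eq_if less_numeral_extra(3))
  with eq have P: "P = [:0, 1:] ^ (K - 1) * B"
    by (simp only: B_def) (simp add: algebra_simps)
  with \<open>P \<noteq> 0\<close> have "B \<noteq> 0" by auto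
  then have "degree P = (K - 1) + degree B"
    unfolding P by (subst degree_mult_eq) (auto simp: degree_power_eq)
  with K have B: "degree B = 0" by simp
  from v show False
  proof
    assume "v = [:0, 1:]"
    then have "B = [:0, 1:] * (r - r \<circ>\<^sub>p [:-1, 1:])" by (simp add: B_def algebra_simps)
    with \<open>B \<noteq> 0\<close> B show False by (auto simp: degree_mult_eq simp del: mult_pCons_left)
  next
    assume v: "v = [:-2, 4:]"
    have "r \<noteq> 0" using \<open>B \<noteq> 0\<close> by (auto simp: B_def)
    have d: "degree (r \<circ>\<^sub>p [:-1, 1:]) = degree r" by (simp add: degree_pcompose)
    have l: "coeff (r \<circ>\<^sub>p [:-1, 1:]) (degree r) = lead_coeff r"
      using lead_coeff_comp[of "[:-1, 1:]" r] by (simp add: d)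
    have "coeff B (Suc (degree r)) = - 3 * lead_coeff r"
      using l by (simp add: B_def v coeff_eq_0 d)
    with \<open>r \<noteq> 0\<close> have "coeff B (Suc (degree r)) \<noteq> 0" by simp
    then have "Suc (degree r) \<le> degree B" by (rule le_degree)
    with B show False by simp
  qed
qed

text \<open>This is the equation \<open>u(T) g(T-1) - g(T) + P(T)/T^K = 0\<close> times
  \<open>T^K\<close>, with \<open>v = T u\<close>. The pole argument makes \<open>g\<close> a
  polynomial, and the degree argument finishes.\<close>

lemma difference_equation_rational:
  fixes P v :: "complex poly"
  assumes g: "rat_germ g"
    and v: "v = [:0, 1:] \<or> v = [:-2, 4:]"
    and K: "K > 0" "degree P < K"
    and eq: "\<forall>\<^sub>F n in sequentially. poly v (of_nat n) * of_nat n ^ (K - 1) * g (n - 1)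
               - of_nat n ^ K * g n + poly P (of_nat n) = 0"
  shows "P = 0"
proof -
  obtain p q where q: "q \<noteq> 0" and cop: "coprime p q"
    and gpq: "\<forall>\<^sub>F n in sequentially. g n = poly p (of_nat n) / poly q (of_nat n)"
    using rat_germ_coprime[OF g] .
  define w where "w = v * [:0, 1:] ^ (K - 1)"
  have "\<forall>\<^sub>F n in sequentially. poly (w * (p \<circ>\<^sub>p [:-1, 1:]) * q
          - [:0, 1:] ^ K * p * (q \<circ>\<^sub>p [:-1, 1:]) + P * q * (q \<circ>\<^sub>p [:-1, 1:])) (of_nat n)
        = poly 0 (of_nat n)"
    using eq gpq eventually_sequentially_pred[OF gpq] eventually_poly_nonzero[OF q]
      eventually_sequentially_pred[OF eventually_poly_nonzero[OF q]] eventually_gt_at_top[of 0]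
  proof eventually_elim
    case (elim n)
    have "of_nat (n - 1) = (of_nat n - 1 :: complex)" using elim by (simp add: of_nat_diff)
    then show ?case using elim
      by (simp add: w_def poly_pcompose field_simps)
  qed
  then have eq': "w * (p \<circ>\<^sub>p [:-1, 1:]) * q
      - [:0, 1:] ^ K * p * (q \<circ>\<^sub>p [:-1, 1:]) + P * q * (q \<circ>\<^sub>p [:-1, 1:]) = 0"
    by (rule poly_eq_if_eventually_eq)
  have "Re z < 1" if "poly w z = 0" for z
  proof -
    have "z = 0 \<or> z = 1 / 2" using that v by (auto simp: w_def field_simps)
    then have "Re z = Re 0 \<or> Re z = Re (1 / 2)" by metis
    then show ?thesis by auto
  qed
  with q cop have "degree q = 0" using eq' by (rule no_poles_of_difference_equation)
  then obtain c where c: "q = [:c:]" "c \<noteq> 0" using q by (auto elim: degree_eq_zeroE)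
  define r where "r = smult (1 / c) p"
  \<comment> \<open>The factor \<open>c * c\<close> is \<open>q(T) q(T-1)\<close> for the constant
    \<open>q = c\<close>.\<close>
  have "smult (c * c) (w * (r \<circ>\<^sub>p [:-1, 1:]) - [:0, 1:] ^ K * r + P) = 0"
    using eq' c by (simp add: r_def pcompose_smult smult_add_right smult_diff_right algebra_simps)
  then have "w * (r \<circ>\<^sub>p [:-1, 1:]) - [:0, 1:] ^ K * r + P = 0" using c by simp
  with v K show ?thesis unfolding w_def by (rule difference_equation_polynomial)
qed

section \<open>Recurrences for the tails\<close>

text \<open>Cancelling factorials gives the ratio \<open>(2n+2)(2n+1)/(n+1)^2\<close>. After a shift
  of the index it becomes the factor \<open>(4T-2)/T\<close>.\<close>

lemma central_binomial_Suc:
  "real (2 * Suc n choose Suc n) * real (Suc n) = real (2 * n choose n) * (4 * real n + 2)"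
proof -
  have c: "real (2 * m choose m) = fact (2 * m) / (fact m * fact m)" for m :: nat
    by (subst binomial_fact) (auto simp: mult_2)
  have f: "fact (2 * Suc n) = (2 * real n + 2) * (2 * real n + 1) * fact (2 * n)"
    by (simp add: algebra_simps)
  have g: "fact (Suc n) = (real n + 1) * fact n" by (simp add: algebra_simps)
  have "(fact n :: real) \<noteq> 0" "real n + 1 \<noteq> 0" by (auto simp del: of_nat_Suc)
  then show ?thesis unfolding c f g by (simp add: divide_simps) (simp add: algebra_simps)
qed

text \<open>The ratio \<open>(4n+2)/(n+1)\<close> is at least 2. This geometric bound drives the
  convergence of the tails.\<close>

lemma central_binomial_ge_power2: "2 ^ n \<le> real (2 * n choose n)"
proof (induction n)
  case (Suc n)
  have "2 ^ Suc n * real (Suc n) \<le> real (2 * n choose n) * (2 * real (Suc n))"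
    using mult_right_mono[OF Suc, of "2 * real (Suc n)"] by (simp add: algebra_simps)
  also have "\<dots> \<le> real (2 * n choose n) * (4 * real n + 2)"
    by (intro mult_left_mono) auto
  also have "\<dots> = real (2 * Suc n choose Suc n) * real (Suc n)"
    by (rule central_binomial_Suc [symmetric])
  finally show ?case by (rule mult_right_le_imp_le) simp
qed simp

section \<open>Tails as sums over decreasing tuples\<close>

definition tail_tuples :: "nat \<Rightarrow> nat \<Rightarrow> nat list set" where
  "tail_tuples r n = {ns. length ns = r \<and> sorted_wrt (>) ns \<and> (\<forall>m\<in>set ns. m > n)}"

text \<open>Appending \<open>n\<close> to the tuple makes the empty composition fit the same formula.\<close>

definition tail_term :: "nat list \<Rightarrow> nat \<Rightarrow> nat list \<Rightarrow> real" where
  "tail_term a n ns = inverse (real ((2 * hd (ns @ [n])) choose hd (ns @ [n]))) *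
     (\<Prod>i<length a. inverse (real (ns ! i) ^ (a ! i)))"

lemma comp_tail_eq_infsum: "comp_tail a n = infsum (tail_term a n) (tail_tuples (length a) n)"
proof (cases "a = []")
  case True
  have "tail_tuples 0 n = {[]}" by (auto simp: tail_tuples_def)
  then show ?thesis by (simp add: True comp_tail_def tail_term_def)
next
  case False
  then have "hd (ns @ [n]) = hd ns" if "ns \<in> tail_tuples (length a) n" for ns
    using that by (cases ns) (auto simp: tail_tuples_def)
  then show ?thesis using False
    by (auto simp: comp_tail_def tail_term_def tail_tuples_def intro!: infsum_cong)
qed

lemma tail_term_nonneg: "tail_term a n ns \<ge> 0"
  unfolding tail_term_def by (intro mult_nonneg_nonneg prod_nonneg) auto

text \<open>The last entry \<open>m\<close> is the smallest index; removing it leaves a term of the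
  tail of \<open>a\<close> at \<open>m\<close>. For \<open>ns = []\<close> the binomial index is
  \<open>m\<close> itself, supplied by the appended entry.\<close>

lemma tail_term_snoc:
  assumes "length ns = length a"
  shows "tail_term (a @ [k]) n (ns @ [m]) = inverse (real m ^ k) * tail_term a m ns"
proof -
  have "(\<Prod>i<length a. inverse (real ((ns @ [m]) ! i) ^ ((a @ [k]) ! i))) =
        (\<Prod>i<length a. inverse (real (ns ! i) ^ (a ! i)))"
    using assms by (intro prod.cong) (auto simp: nth_append)
  moreover have "hd (ns @ m # [n]) = hd (ns @ [m])" by (cases ns) auto
  ultimately show ?thesis
    using assms by (simp add: tail_term_def nth_append)
qed

text \<open>Turns the sum over tuples into an iterated one: first the smallest index
  \<open>m > n\<close>, then the other indices above \<open>m\<close>.\<close>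

lemma bij_betw_tail_tuples_Suc:
  "bij_betw (\<lambda>(m, ns). ns @ [m]) (Sigma {n<..} (tail_tuples r)) (tail_tuples (Suc r) n)"
proof (rule bij_betw_byWitness[where f' = "\<lambda>ns. (last ns, butlast ns)"])
  show "\<forall>x\<in>Sigma {n<..} (tail_tuples r).
      (last (case x of (m, ns) \<Rightarrow> ns @ [m]), butlast (case x of (m, ns) \<Rightarrow> ns @ [m])) = x"
    by auto
  show "\<forall>ns\<in>tail_tuples (Suc r) n. (case (last ns, butlast ns) of (m, ns) \<Rightarrow> ns @ [m]) = ns"
    by (auto simp: tail_tuples_def intro!: append_butlast_last_id)
  show "(\<lambda>(m, ns). ns @ [m]) ` Sigma {n<..} (tail_tuples r) \<subseteq> tail_tuples (Suc r) n"
    by (fastforce simp: tail_tuples_def sorted_wrt_append)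
  show "(\<lambda>ns. (last ns, butlast ns)) ` tail_tuples (Suc r) n \<subseteq> Sigma {n<..} (tail_tuples r)"
  proof (rule image_subsetI)
    fix ns assume ns: "ns \<in> tail_tuples (Suc r) n"
    then obtain ms m where "ns = ms @ [m]"
      by (cases ns rule: rev_cases) (auto simp: tail_tuples_def)
    with ns show "(last ns, butlast ns) \<in> Sigma {n<..} (tail_tuples r)"
      by (auto simp: tail_tuples_def sorted_wrt_append)
  qed
qed

lemma has_sum_power_half:
  fixes n :: nat
  shows "((\<lambda>m. (1 / 2 :: real) ^ m) has_sum (1 / 2) ^ n) {n<..}"
proof -
  have "(\<lambda>m. (1 / 2 :: real) ^ Suc n * (1 / 2) ^ m) sums ((1 / 2) ^ Suc n * (1 / (1 - 1 / 2)))"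
    by (intro sums_mult geometric_sums) auto
  then have "(\<lambda>m. (1 / 2 :: real) ^ (m + Suc n)) sums (1 / 2) ^ n"
    by (simp add: power_add mult_ac)
  then have "((\<lambda>m. (1 / 2 :: real) ^ (m + Suc n)) has_sum (1 / 2) ^ n) UNIV"
    by (intro sums_nonneg_imp_has_sum) auto
  moreover have "bij_betw (\<lambda>m. m + Suc n) UNIV {n<..}"
    by (rule bij_betw_byWitness[where f' = "\<lambda>m. m - Suc n"]) auto
  ultimately show ?thesis
    using has_sum_reindex_bij_betw[of "\<lambda>m. m + Suc n" UNIV "{n<..}" "\<lambda>m. (1 / 2 :: real) ^ m"]
    by simp
qed

text \<open>
  The bound \<open>2\<^sup>-\<^sup>n\<close> reproduces itself, since \<open>2\<^sup>-\<^sup>n\<close> is the sum of \<open>2\<^sup>-\<^sup>m\<close> over \<open>m > n\<close>.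
\<close>

lemma tail_term_snoc_has_sum:
  fixes a :: "nat list" and k n :: nat
  assumes summable: "\<And>m. tail_term a m summable_on tail_tuples (length a) m"
    and bound: "\<And>m. comp_tail a m \<le> (1 / 2) ^ m"
  defines "h \<equiv> \<lambda>m. inverse (real m ^ k) * comp_tail a m"
  shows "h summable_on {n<..}"
    and "(tail_term (a @ [k]) n has_sum infsum h {n<..}) (tail_tuples (Suc (length a)) n)"
    and "infsum h {n<..} \<le> (1 / 2) ^ n"
proof -
  have inner: "((\<lambda>ns. inverse (real m ^ k) * tail_term a m ns) has_sum h m)
      (tail_tuples (length a) m)" for m
    unfolding h_def comp_tail_eq_infsum
    by (intro has_sum_cmult_right has_sum_infsum summable)
  have h_nonneg: "h m \<ge> 0" for m
    unfolding h_def comp_tail_eq_infsum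
    by (intro mult_nonneg_nonneg infsum_nonneg tail_term_nonneg) auto
  have h_le: "h m \<le> (1 / 2) ^ m" if "m \<in> {n<..}" for m
  proof -
    have "inverse (real m ^ k) \<le> 1" using that by (intro inverse_le_1_iff[THEN iffD2]) auto
    moreover have "comp_tail a m \<ge> 0"
      unfolding comp_tail_eq_infsum by (intro infsum_nonneg tail_term_nonneg)
    ultimately have "h m \<le> 1 * comp_tail a m" unfolding h_def by (intro mult_right_mono)
    with bound[of m] show ?thesis by simp
  qed
  have half: "(\<lambda>m. (1 / 2 :: real) ^ m) summable_on {n<..}"
    using has_sum_power_half[of n] by (rule has_sum_imp_summable)
  show h_summable: "h summable_on {n<..}"
    using half by (rule summable_on_comparison_test) (use h_le h_nonneg in auto)
  \<comment> \<open>The terms are nonnegative, so summability of the row sums \<open>h\<close> gives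
    joint summability, which permits summing row by row.\<close>
  have sigma: "(\<lambda>(m, ns). inverse (real m ^ k) * tail_term a m ns) summable_on
      Sigma {n<..} (tail_tuples (length a))"
    by (rule summable_on_SigmaI[OF _ h_summable]) (auto intro!: inner mult_nonneg_nonneg tail_term_nonneg)
  have "((\<lambda>(m, ns). inverse (real m ^ k) * tail_term a m ns) has_sum infsum h {n<..})
      (Sigma {n<..} (tail_tuples (length a)))"
    by (rule has_sum_SigmaI[OF _ has_sum_infsum[OF h_summable] sigma]) (auto intro!: inner)
  also have "?this \<longleftrightarrow> ((\<lambda>x. tail_term (a @ [k]) n (case x of (m, ns) \<Rightarrow> ns @ [m]))
      has_sum infsum h {n<..}) (Sigma {n<..} (tail_tuples (length a)))"
    by (intro has_sum_cong) (auto simp: tail_tuples_def tail_term_snoc)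
  also have "\<dots> \<longleftrightarrow> (tail_term (a @ [k]) n has_sum infsum h {n<..})
      (tail_tuples (Suc (length a)) n)"
    by (intro has_sum_reindex_bij_betw bij_betw_tail_tuples_Suc)
  finally show "(tail_term (a @ [k]) n has_sum infsum h {n<..})
      (tail_tuples (Suc (length a)) n)" .
  have "infsum h {n<..} \<le> infsum (\<lambda>m. (1 / 2) ^ m) {n<..}"
    using h_summable half h_le by (rule infsum_mono)
  also have "\<dots> = (1 / 2) ^ n" using has_sum_power_half by (rule infsumI)
  finally show "infsum h {n<..} \<le> (1 / 2) ^ n" .
qed

text \<open>The claims are proved together: the bound for \<open>a\<close> makes the sum for
  \<open>a @ [k]\<close> converge.\<close>

lemma tail_term_summable_and_bound:
  "tail_term a n summable_on tail_tuples (length a) n \<and> comp_tail a n \<le> (1 / 2) ^ n"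
proof (induction a arbitrary: n rule: rev_induct)
  case Nil
  have "tail_tuples 0 n = {[]}" by (auto simp: tail_tuples_def)
  moreover have "inverse (real (2 * n choose n)) \<le> inverse (2 ^ n)"
    using central_binomial_ge_power2 by (intro le_imp_inverse_le) auto
  ultimately show ?case by (simp add: comp_tail_def power_one_over inverse_eq_divide)
next
  case (snoc k a)
  have "tail_term a m summable_on tail_tuples (length a) m" "comp_tail a m \<le> (1 / 2) ^ m" for m
    using snoc by auto
  from tail_term_snoc_has_sum(2,3)[OF this, of k n] show ?case
    by (auto simp: comp_tail_eq_infsum infsumI has_sum_imp_summable)
qed

text \<open>Summed over its smallest index \<open>m > n\<close>, the tail gains exactly the term
  \<open>m = n\<close> when \<open>n\<close> is replaced by \<open>n - 1\<close>.\<close>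

lemma comp_tail_pred:
  assumes "a \<noteq> []" "n > 0"
  shows "comp_tail a (n - 1) =
    comp_tail a n + inverse (real n ^ last a) * comp_tail (butlast a) n"
proof -
  obtain b k where a: "a = b @ [k]" using assms(1) by (metis append_butlast_last_id)
  define h where "h m = inverse (real m ^ k) * comp_tail b m" for m
  have sb: "tail_term b m summable_on tail_tuples (length b) m" "comp_tail b m \<le> (1 / 2) ^ m" for m
    using tail_term_summable_and_bound by auto
  have eq: "comp_tail a m = infsum h {m<..}" for m
    using infsumI[OF tail_term_snoc_has_sum(2)[OF sb, of k m]]
    by (simp add: a comp_tail_eq_infsum[of "b @ [k]"] h_def[abs_def])
  have "{n - 1<..} = insert n {n<..}" using assms(2) by auto
  moreover have "h summable_on {n<..}"
    unfolding h_def by (rule tail_term_snoc_has_sum(1)[OF sb])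
  ultimately have "comp_tail a (n - 1) = h n + comp_tail a n"
    unfolding eq by (simp add: infsum_insert)
  then show ?thesis by (simp add: a h_def)
qed

lemma comp_tail_Nil_pred:
  assumes "n > 0"
  shows "comp_tail [] (n - 1) = (4 * real n - 2) / real n * comp_tail [] n"
proof -
  obtain m where n: "n = Suc m" using assms by (cases n) auto
  have "real (2 * m choose m) > 0" "real (2 * n choose n) > 0" by auto
  with central_binomial_Suc[of m] show ?thesis
    unfolding comp_tail_def n by (simp add: divide_simps) (simp add: algebra_simps)
qed

section \<open>Linear independence\<close>

lemma eventually_const_if_eventually_pred_eq:
  fixes g :: "nat \<Rightarrow> 'a"
  assumes "\<forall>\<^sub>F n in sequentially. g (n - 1) = g n"
  shows "\<exists>c. \<forall>\<^sub>F n in sequentially. g n = c"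
proof -
  obtain N where N: "\<And>n. n \<ge> N \<Longrightarrow> g (n - 1) = g n"
    using assms by (auto simp: eventually_sequentially)
  have "g n = g N" if "n \<ge> N" for n
    using that
  proof (induction n rule: dec_induct)
    case (step n)
    then show ?case using N[of "Suc n"] by simp
  qed simp
  then show ?thesis by (auto simp: eventually_sequentially)
qed

abbreviation (input) comp_tail_complex :: "nat list \<Rightarrow> nat \<Rightarrow> complex" where
  "comp_tail_complex a n \<equiv> complex_of_real (comp_tail a n)"

text \<open>The inductive step of the independence, with \<open>IH\<close> the statement for
  \<open>A - {a}\<close>. It settles only the coefficient of \<open>a\<close>; the others follow by
  using \<open>IH\<close> once more.\<close>

lemma top_coefficient_eventually_zero:
  fixes f :: "nat list \<Rightarrow> nat \<Rightarrow> complex"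
  assumes fin: "finite A" and closed: "\<And>a. a \<in> A \<Longrightarrow> a \<noteq> [] \<Longrightarrow> butlast a \<in> A"
    and comp: "A \<subseteq> compositions"
    and rat: "\<And>a. a \<in> A \<Longrightarrow> rat_germ (f a)"
    and rel: "\<forall>\<^sub>F n in sequentially. (\<Sum>a\<in>A. f a n * comp_tail_complex a n) = 0"
    and top: "a \<in> A" "\<And>b. b \<in> A \<Longrightarrow> length b \<le> length a"
    and IH: "\<And>h b. (\<And>b. b \<in> A - {a} \<Longrightarrow> rat_germ (h b)) \<Longrightarrow>
        \<forall>\<^sub>F n in sequentially. (\<Sum>b\<in>A - {a}. h b n * comp_tail_complex b n) = 0 \<Longrightarrow>
        b \<in> A - {a} \<Longrightarrow> \<forall>\<^sub>F n in sequentially. h b n = 0"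
  shows "\<forall>\<^sub>F n in sequentially. f a n = 0"
proof (cases "a = []")
  case True
  then have "A = {[]}" using top by auto
  then show ?thesis
    using rel by (simp add: True comp_tail_def)
next
  case False
  show ?thesis
  proof (rule ccontr)
    assume "\<not> ?thesis"
    then have nz: "\<forall>\<^sub>F n in sequentially. f a n \<noteq> 0"
      using rat_germ_zero_or_nonzero[OF rat[OF top(1)]] by blast
    define F where "F b n = f b n / f a n" for b n
    have F_rat: "rat_germ (F b)" if "b \<in> A" for b
      unfolding F_def using that top(1) by (intro rat_germ_divide rat)
    have F_a: "\<forall>\<^sub>F n in sequentially. F a n = 1"
      using nz by eventually_elim (simp add: F_def)
    have F_rel: "\<forall>\<^sub>F n in sequentially. (\<Sum>b\<in>A. F b n * comp_tail_complex b n) = 0"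
      using rel
    proof eventually_elim
      case (elim n)
      have "(\<Sum>b\<in>A. F b n * comp_tail_complex b n) =
            (\<Sum>b\<in>A. f b n * comp_tail_complex b n) / f a n"
        by (simp add: F_def sum_divide_distrib)
      with elim show ?case by simp
    qed
    \<comment> \<open>\<open>C b\<close> is the set of children of \<open>b\<close>, whose tails at
      \<open>n - 1\<close> contribute to sigma(b)_n, and \<open>u\<close> is the diagonal factor of
      the recurrences. Then \<open>h b\<close> is the coefficient of sigma(b)_n in
      \<open>F(n-1) - F(n)\<close> with all tails rewritten at \<open>n\<close>.\<close>
    define C where "C b = {c \<in> A - {[]}. butlast c = b}" for b
    define u :: "nat list \<Rightarrow> nat \<Rightarrow> complex" where
      "u b n = (if b = [] then (4 * of_nat n - 2) / of_nat n else 1)" for b n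
    define h where
      "h b n = u b n * F b (n - 1) - F b n + (\<Sum>c\<in>C b. F c (n - 1) / of_nat n ^ last c)" for b n
    have finC: "finite (C b)" for b using fin by (simp add: C_def)
    have C_A: "C b \<subseteq> A" for b by (auto simp: C_def)
    have "rat_germ (\<lambda>n. (4 * of_nat n - 2) / of_nat n)"
      by (intro rat_germ_divide rat_germ_diff rat_germ_mult rat_germ_const rat_germ_of_nat)
    then have u_rat: "rat_germ (u b)" for b
      unfolding u_def by (cases "b = []") (auto intro: rat_germ_const)
    have h_rat: "rat_germ (h b)" if "b \<in> A" for b
      unfolding h_def using that C_A
      by (intro rat_germ_add rat_germ_diff rat_germ_mult u_rat rat_germ_pred rat_germ_sum
          rat_germ_divide rat_germ_power rat_germ_of_nat F_rat) auto
    have shift: "comp_tail_complex b (n - 1) = u b n * comp_tail_complex b n +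
        (if b = [] then 0 else comp_tail_complex (butlast b) n / of_nat n ^ last b)"
      if "n > 0" for b n
    proof (cases "b = []")
      case True
      then show ?thesis using comp_tail_Nil_pred[OF that] by (simp add: u_def)
    next
      case False
      then show ?thesis using comp_tail_pred[OF False that] by (simp add: u_def field_simps)
    qed
    have group: "(\<Sum>b\<in>A. F b (n - 1) *
          (if b = [] then 0 else comp_tail_complex (butlast b) n / of_nat n ^ last b)) =
        (\<Sum>b\<in>A. (\<Sum>c\<in>C b. F c (n - 1) / of_nat n ^ last c) * comp_tail_complex b n)" for n
    proof -
      have "(\<Sum>b\<in>A. F b (n - 1) *
          (if b = [] then 0 else comp_tail_complex (butlast b) n / of_nat n ^ last b)) =
        (\<Sum>c\<in>A - {[]}. F c (n - 1) / of_nat n ^ last c * comp_tail_complex (butlast c) n)"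
        using fin by (intro sum.mono_neutral_cong_right) auto
      \<comment> \<open>Terms are sorted by parent, which lies in \<open>A\<close> by
        prefix-closedness.\<close>
      also have "\<dots> = (\<Sum>b\<in>A. \<Sum>c\<in>C b.
          F c (n - 1) / of_nat n ^ last c * comp_tail_complex (butlast c) n)"
        unfolding C_def using fin closed by (intro sum.group [symmetric]) auto
      also have "\<dots> = (\<Sum>b\<in>A. (\<Sum>c\<in>C b. F c (n - 1) / of_nat n ^ last c) * comp_tail_complex b n)"
        by (intro sum.cong refl) (auto simp: C_def sum_distrib_right)
      finally show ?thesis .
    qed
    have h_rel: "\<forall>\<^sub>F n in sequentially. (\<Sum>b\<in>A. h b n * comp_tail_complex b n) = 0"
      using F_rel eventually_sequentially_pred[OF F_rel] eventually_gt_at_top[of 0]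
    proof eventually_elim
      case (elim n)
      have "(\<Sum>b\<in>A. F b (n - 1) * comp_tail_complex b (n - 1)) =
          (\<Sum>b\<in>A. F b (n - 1) * (u b n * comp_tail_complex b n)) +
          (\<Sum>b\<in>A. (\<Sum>c\<in>C b. F c (n - 1) / of_nat n ^ last c) * comp_tail_complex b n)"
        unfolding shift[OF elim(3)] distrib_left sum.distrib group ..
      moreover have "(\<Sum>b\<in>A. h b n * comp_tail_complex b n) =
          (\<Sum>b\<in>A. F b (n - 1) * (u b n * comp_tail_complex b n)) -
          (\<Sum>b\<in>A. F b n * comp_tail_complex b n) +
          (\<Sum>b\<in>A. (\<Sum>c\<in>C b. F c (n - 1) / of_nat n ^ last c) * comp_tail_complex b n)"
        unfolding h_def by (simp add: algebra_simps sum.distrib sum_subtractf)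
      ultimately show ?case using elim by simp
    qed
    \<comment> \<open>At maximal depth there are no children in \<open>A\<close>, and
      \<open>u = 1\<close> because the depth is positive.\<close>
    have h_top: "h c = (\<lambda>n. F c (n - 1) - F c n)" if "c \<in> A" "length c = length a" for c
    proof -
      have "C c = {}"
      proof (rule ccontr)
        assume "C c \<noteq> {}"
        then obtain d where d: "d \<in> A" "d \<noteq> []" "butlast d = c" by (auto simp: C_def)
        then have "length d = Suc (length c)" by (cases d rule: rev_cases) auto
        with top(2)[OF d(1)] that show False by simp
      qed
      moreover have "c \<noteq> []" using that False by auto
      ultimately show ?thesis by (simp add: h_def u_def fun_eq_iff)
    qed
    have h_a: "\<forall>\<^sub>F n in sequentially. h a n = 0"
      using F_a eventually_sequentially_pred[OF F_a]
      by eventually_elim (simp add: h_top[OF top(1)])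
    have "\<forall>\<^sub>F n in sequentially. (\<Sum>b\<in>A - {a}. h b n * comp_tail_complex b n) = 0"
      using h_rel h_a by eventually_elim (simp add: sum.remove[OF fin top(1)])
    then have h_zero: "\<forall>\<^sub>F n in sequentially. h b n = 0" if "b \<in> A" for b
      using that h_a IH[of h b] h_rat by (cases "b = a") auto
    \<comment> \<open>All children of \<open>b\<close> have the depth of \<open>a\<close>, so
      \<open>h_zero\<close> makes their coefficients eventually constant, and \<open>h b = 0\<close>
      becomes the difference equation for \<open>F b\<close>.\<close>
    define b where "b = butlast a"
    have b: "b \<in> A" "a \<in> C b" using top(1) False closed by (auto simp: b_def C_def)
    have C_len: "length c = length a" if "c \<in> C b" for c
    proof -
      have "length (butlast c) = length (butlast a)" "c \<noteq> []"
        using that by (auto simp: C_def b_def)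
      with False show ?thesis by (cases c rule: rev_cases; cases a rule: rev_cases) auto
    qed
    have "\<exists>\<kappa>. \<forall>\<^sub>F n in sequentially. F c n = \<kappa>" if "c \<in> C b" for c
    proof (rule eventually_const_if_eventually_pred_eq)
      have c: "c \<in> A" using that C_A by blast
      show "\<forall>\<^sub>F n in sequentially. F c (n - 1) = F c n"
        using h_zero[OF c] unfolding h_top[OF c C_len[OF that]] by simp
    qed
    then obtain \<kappa> where \<kappa>: "\<And>c. c \<in> C b \<Longrightarrow> \<forall>\<^sub>F n in sequentially. F c n = \<kappa> c"
      by metis
    have "\<forall>\<^sub>F n::nat in sequentially. \<kappa> a = 1"
      using \<kappa>[OF b(2)] F_a by eventually_elim simp
    then have \<kappa>_a: "\<kappa> a = 1" by simp
    \<comment> \<open>Multiplying by \<open>T^K\<close>, with \<open>K\<close> the largest last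
      entry, turns the sum of the \<open>\<kappa> c / T^(last c)\<close> into the polynomial
      \<open>P\<close>; its degree is below \<open>K\<close> because entries are positive.\<close>
    define K where "K = Max (last ` C b)"
    have last_pos: "0 < last c" if "c \<in> C b" for c
      using that comp by (auto simp: C_def compositions_def)
    have last_le: "last c \<le> K" if "c \<in> C b" for c
      using that finC by (simp add: K_def)
    have "K > 0" using last_pos[OF b(2)] last_le[OF b(2)] by simp
    define P where "P = (\<Sum>c\<in>C b. monom (\<kappa> c) (K - last c))"
    have deg: "degree P < K"
      unfolding P_def using \<open>K > 0\<close> last_pos
      by (intro degree_sum_less) (auto intro: le_less_trans[OF degree_monom_le])
    \<comment> \<open>\<open>v = T u\<close>, which uses up one of the \<open>K\<close> factors
      \<open>T\<close>.\<close>
    define v :: "complex poly" where "v = (if b = [] then [:-2, 4:] else [:0, 1:])"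
    have "\<forall>\<^sub>F n in sequentially. \<forall>c\<in>C b. F c (n - 1) = \<kappa> c"
      using finC by (intro eventually_ball_finite ballI eventually_sequentially_pred \<kappa>)
    then have "\<forall>\<^sub>F n in sequentially. poly v (of_nat n) * of_nat n ^ (K - 1) * F b (n - 1)
               - of_nat n ^ K * F b n + poly P (of_nat n) = 0"
      using h_zero[OF b(1)] eventually_gt_at_top[of 0]
    proof eventually_elim
      case (elim n)
      have n: "of_nat n \<noteq> (0 :: complex)" using elim by simp
      have "of_nat n ^ K = of_nat n * (of_nat n ^ (K - 1) :: complex)"
        using \<open>K > 0\<close> by (metis power_eq_if less_numeral_extra(3))
      then have "of_nat n ^ K * u b n = poly v (of_nat n) * of_nat n ^ (K - 1)"
        using n by (simp add: u_def v_def algebra_simps)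
      moreover have "of_nat n ^ K * (\<Sum>c\<in>C b. F c (n - 1) / of_nat n ^ last c) = poly P (of_nat n)"
        unfolding P_def poly_sum sum_distrib_left
        using elim n last_le by (intro sum.cong) (auto simp: poly_monom power_diff)
      ultimately have "poly v (of_nat n) * of_nat n ^ (K - 1) * F b (n - 1)
          - of_nat n ^ K * F b n + poly P (of_nat n) = of_nat n ^ K * h b n"
        by (simp add: h_def algebra_simps)
      with elim show ?case by simp
    qed
    moreover have "v = [:0, 1:] \<or> v = [:-2, 4:]" by (simp add: v_def)
    ultimately have "P = 0"
      using F_rat[OF b(1)] \<open>K > 0\<close> deg by (intro difference_equation_rational)
    \<comment> \<open>Children of \<open>b\<close> differ in their last entries, all at most
      \<open>K\<close>, so their monomials have distinct degrees and nothing cancels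
      \<open>\<kappa> a = 1\<close>.\<close>
    have "coeff P (K - last a) = (\<Sum>c\<in>C b. if c = a then \<kappa> c else 0)"
      unfolding P_def coeff_sum
    proof (intro sum.cong refl)
      fix c assume c: "c \<in> C b"
      have "c = a" if "K - last c = K - last a"
      proof -
        have "last c = last a" using that last_le[OF c] last_le[OF b(2)] by simp
        moreover have "butlast c = butlast a" "c \<noteq> []" using c by (auto simp: C_def b_def)
        ultimately show ?thesis using False by (metis append_butlast_last_id)
      qed
      then show "coeff (monom (\<kappa> c) (K - last c)) (K - last a) = (if c = a then \<kappa> c else 0)"
        by auto
    qed
    also have "\<dots> = 1" using finC b(2) by (simp add: \<kappa>_a)
    finally show False using \<open>P = 0\<close> by simp
  qed
qed

text \<open>Induction on the size of \<open>A\<close>: an element of maximal depth is not a proper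
  prefix of another, so removing it keeps \<open>A\<close> prefix-closed.\<close>

lemma comp_tail_linearly_independent:
  fixes f :: "nat list \<Rightarrow> nat \<Rightarrow> complex"
  assumes "finite A" "\<And>a. a \<in> A \<Longrightarrow> a \<noteq> [] \<Longrightarrow> butlast a \<in> A" "A \<subseteq> compositions"
    and "\<And>a. a \<in> A \<Longrightarrow> rat_germ (f a)"
    and "\<forall>\<^sub>F n in sequentially. (\<Sum>a\<in>A. f a n * comp_tail_complex a n) = 0"
    and "a \<in> A"
  shows "\<forall>\<^sub>F n in sequentially. f a n = 0"
  using assms
proof (induction "card A" arbitrary: A f a rule: less_induct)
  case (less A f b)
  have "A \<noteq> {}" using less.prems by auto
  then obtain a where a: "a \<in> A" "\<And>b. b \<in> A \<Longrightarrow> length b \<le> length a"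
    using ex_is_arg_min_if_finite[OF less.prems(1), of "\<lambda>b. - int (length b)"]
    by (auto simp: is_arg_min_def not_less)
  have closed: "butlast c \<in> A - {a}" if "c \<in> A - {a}" "c \<noteq> []" for c
  proof -
    have "length (butlast c) < length a"
      using a(2)[of c] that by (cases c rule: rev_cases) auto
    then show ?thesis using that less.prems(2) by auto
  qed
  have card: "card (A - {a}) < card A" using less.prems(1) a(1) by (rule card_Diff1_less)
  have IH: "\<forall>\<^sub>F n in sequentially. h c n = 0"
    if "\<And>b. b \<in> A - {a} \<Longrightarrow> rat_germ (h b)"
      "\<forall>\<^sub>F n in sequentially. (\<Sum>b\<in>A - {a}. h b n * comp_tail_complex b n) = 0"
      "c \<in> A - {a}" for h c
    by (rule less.hyps[OF card _ closed _ that]) (use less.prems in auto)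
  have fa: "\<forall>\<^sub>F n in sequentially. f a n = 0"
    using less.prems(1-5) a IH by (rule top_coefficient_eventually_zero)
  have "\<forall>\<^sub>F n in sequentially. (\<Sum>b\<in>A - {a}. f b n * comp_tail_complex b n) = 0"
    using less.prems(5) fa by eventually_elim (simp add: sum.remove[OF less.prems(1) a(1)])
  then show ?case
    using fa IH[of f b] less.prems by (cases "b = a") auto
qed

section \<open>From germs back to rational functions\<close>

lemma rat_germ_eval_fract: "rat_germ (\<lambda>n. eval_fract f (of_nat n))"
  unfolding eval_fract_def rat_germ_def
  by (intro exI[of _ "fst (quot_of_fract f)"] exI[of _ "snd (quot_of_fract f)"]) simp

lemma eval_fract_eventually_zero_imp:
  assumes "\<forall>\<^sub>F n in sequentially. eval_fract f (of_nat n) = 0"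
  shows "f = 0"
proof -
  have "\<forall>\<^sub>F n in sequentially. poly (fst (quot_of_fract f)) (of_nat n) = poly 0 (of_nat n)"
    using assms eventually_poly_nonzero[OF snd_quot_of_fract_nonzero, of f]
    by eventually_elim (simp add: eval_fract_def)
  then have "fst (quot_of_fract f) = 0" by (rule poly_eq_if_eventually_eq)
  then show ?thesis by simp
qed

theorem theorem9:
  fixes f :: "nat list \<Rightarrow> complex poly fract"
  assumes "finite {a \<in> compositions. f a \<noteq> 0}"
    and "eventually (\<lambda>n. (\<Sum>a \<in> {a \<in> compositions. f a \<noteq> 0}.
            eval_fract (f a) (of_nat n) * complex_of_real (comp_tail a n)) = 0) sequentially"
  shows "\<forall>a\<in>compositions. f a = 0"
proof -
  define S where "S = {a \<in> compositions. f a \<noteq> 0}"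
  \<comment> \<open>\<open>A\<close> is the prefix closure of the support; the added compositions
    have coefficient zero, so the relation is unchanged.\<close>
  define A where "A = (\<Union>b\<in>S. (\<lambda>i. take i b) ` {..length b})"
  have fin: "finite A" using assms(1) by (simp add: A_def S_def)
  have S_A: "S \<subseteq> A" by (force simp: A_def)
  have A_comp: "A \<subseteq> compositions"
    by (auto simp: A_def S_def compositions_def dest: in_set_takeD)
  have closed: "butlast a \<in> A" if "a \<in> A" for a
  proof -
    obtain b i where "b \<in> S" "i \<le> length b" "a = take i b" using \<open>a \<in> A\<close> by (auto simp: A_def)
    then have "butlast a = take (i - 1) b" "i - 1 \<le> length b" by (auto simp: butlast_take)
    with \<open>b \<in> S\<close> show ?thesis by (auto simp: A_def)
  qed
  have "(\<Sum>a\<in>A. eval_fract (f a) (of_nat n) * comp_tail_complex a n) =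
        (\<Sum>a\<in>S. eval_fract (f a) (of_nat n) * comp_tail_complex a n)" for n
    using fin S_A A_comp
    by (intro sum.mono_neutral_right) (auto simp: S_def eval_fract_def)
  with assms(2) have rel: "\<forall>\<^sub>F n in sequentially.
      (\<Sum>a\<in>A. eval_fract (f a) (of_nat n) * comp_tail_complex a n) = 0"
    by (simp add: S_def)
  have "f a = 0" if "a \<in> A" for a
    by (rule eval_fract_eventually_zero_imp,
        rule comp_tail_linearly_independent[OF fin closed A_comp rat_germ_eval_fract rel that])
  with S_A show ?thesis by (auto simp: S_def)
qed

end
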